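(* Let $\mathcal{G}=(\mathcal{S}_{\mathcal G},\mathcal{M}_{\mathcal G},\mathcal{B}(H_{\mathcal G}))$ and $\mathcal{H}=(\mathcal{S}_{\mathcal H},\mathcal{M}_{\mathcal H},\mathcal{B}(H_{\mathcal H}))$ be quantum graphs, and let $\mathcal{G}\times\mathcal{H}$ be their categorical product. Then $$\chi_q(\mathcal{G}\times\mathcal{H})\leq\min\{\chi_q(\mathcal{G}),\chi_q(\mathcal{H})\}.$$
   Context: Quantum graphs. $H$ denotes a complex Hilbert space, $\mathcal{B}(H)$ its bounded operators, and $\mathcal{M}'$ the commutant of $\mathcal{M}$. An (irreflexive) quantum graph is a tuple $(\mathcal{S},\mathcal{M},\mathcal{B}(H))$ where $\mathcal{M}$ is a von Neumann subalgebra of $\mathcal{B}(H)$ and $\mathcal{S}\subseteq\mathcal{B}(H)$ is an operator space that is closed under adjoints, is a bimodule over $\mathcal{M}'$ (that is, $\mathcal{M}'\mathcal{S}\mathcal{M}'\subseteq\mathcal{S}$), and is contained in $(\mathcal{M}')^{\perp}$, the orthogonal complement being taken relative to some trace on $\mathcal{B}(H)$. Quantum chromatic number. $\chi_q(\mathcal{S},\mathcal{M},\mathcal{B}(H))$ is the minimum $c\in\mathbb{N}$ for which there are a finite-dimensional von Neumann algebra $\mathcal{N}$ (with a faithful normal tracial state) and operators $P_1,\dots,P_c\in\mathcal{M}\bar\otimes\mathcal{N}$ with $P_a^2=P_a=P_a^*$ for $1\le a\le c$, $\sum_{a=1}^cP_a=I_{\mathcal{M}\bar\otimes\mathcal{N}}$,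 and $P_a(X\otimes I_{\mathcal{N}})P_a=0$ for all $X\in\mathcal{S}$ and $1\le a\le c$; it is $\infty$ if none exists. Categorical product. $\mathcal{G}\times\mathcal{H}=(\mathcal{S}_{\mathcal G}\otimes\mathcal{S}_{\mathcal H},\ \mathcal{M}_{\mathcal G}\bar\otimes\mathcal{M}_{\mathcal H},\ \mathcal{B}(H_{\mathcal G}\bar\otimes H_{\mathcal H}))$. *)

theory Defs
  imports
    "HOL-Analysis.Elementary_Normed_Spaces"
    "HOL-Library.Extended_Nat"
    "HOL-Library.Extended_Nonnegative_Real"
    "HOL-Library.Complex_Order"
    "Jordan_Normal_Form.Matrix"
begin

section \<open>Complex Hilbert spaces\<close>

class complex_vector = ab_group_add +
  fixes scaleC :: "complex \<Rightarrow> 'a \<Rightarrow> 'a"  (infixr "*\<^sub>C" 75)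
  assumes scaleC_add_right: "c *\<^sub>C (x + y) = c *\<^sub>C x + c *\<^sub>C y"
    and scaleC_add_left: "(c + d) *\<^sub>C x = c *\<^sub>C x + d *\<^sub>C x"
    and scaleC_scaleC: "c *\<^sub>C d *\<^sub>C x = (c * d) *\<^sub>C x"
    and scaleC_one: "1 *\<^sub>C x = x"

definition csubspace :: "'a::complex_vector set \<Rightarrow> bool" where
  "csubspace V \<longleftrightarrow> 0 \<in> V \<and> (\<forall>x\<in>V. \<forall>y\<in>V. x + y \<in> V) \<and> (\<forall>c. \<forall>x\<in>V. c *\<^sub>C x \<in> V)"

definition cspan :: "'a::complex_vector set \<Rightarrow> 'a set" where
  "cspan A = csubspace hull A"

text \<open>The norm and topology are those of the underlying real inner product space; its inner
  product is the real part of \<open>cinner\<close>, which is conjugate-linear in the first argument.\<close>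

class complex_inner = complex_vector + real_inner +
  fixes cinner :: "'a \<Rightarrow> 'a \<Rightarrow> complex"
  assumes scaleC_of_real: "complex_of_real r *\<^sub>C x = r *\<^sub>R x"
    and cinner_commute: "cinner x y = cnj (cinner y x)"
    and cinner_add_right: "cinner x (y + z) = cinner x y + cinner x z"
    and cinner_scaleC_right: "cinner x (c *\<^sub>C y) = c * cinner x y"
    and Re_cinner: "Re (cinner x y) = inner x y"

class chilbert_space = complex_inner + complete_space

instantiation complex :: chilbert_space
begin

definition scaleC_complex :: "complex \<Rightarrow> complex \<Rightarrow> complex" where
  "scaleC_complex = (*)"

definition cinner_complex :: "complex \<Rightarrow> complex \<Rightarrow> complex" where
  "cinner_complex x y = cnj x * y"

instance
  by standard
    (auto simp: scaleC_complex_def cinner_complex_def inner_complex_def algebra_simps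
      scaleR_conv_of_real)

end


section \<open>The algebra of bounded operators\<close>

lemma scaleC_zero_right [simp]: "c *\<^sub>C (0::'a::complex_vector) = 0"
  using scaleC_add_right [of c 0 "0::'a"] by simp

lemma scaleC_minus_right: "c *\<^sub>C (- x) = - (c *\<^sub>C (x::'a::complex_vector))"
  using scaleC_add_right [of c x "- x"] by (simp add: eq_neg_iff_add_eq_0 add.commute)

lemma scaleC_diff_right: "c *\<^sub>C (x - y) = c *\<^sub>C x - c *\<^sub>C (y::'a::complex_vector)"
  using scaleC_add_right [of c x "- y"] by (simp add: scaleC_minus_right)

lemma scaleC_commute: "c *\<^sub>C d *\<^sub>C x = d *\<^sub>C c *\<^sub>C (x::'a::complex_vector)"
  by (simp add: scaleC_scaleC mult.commute)

lemma cinner_scaleC_left: "cinner (c *\<^sub>C x) y = cnj c * cinner x (y::'a::complex_inner)"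
  by (metis cinner_commute cinner_scaleC_right complex_cnj_mult)

lemma norm_scaleC: "norm (c *\<^sub>C x) = cmod c * norm (x::'a::complex_inner)"
proof -
  have *: "complex_of_real (inner z z) = cinner z z" for z :: 'a
  proof -
    have "Im (cinner z z) = - Im (cinner z z)"
      using arg_cong [OF cinner_commute [of z z], of Im] by simp
    then show ?thesis
      by (simp add: complex_eq_iff Re_cinner)
  qed
  have "complex_of_real (inner (c *\<^sub>C x) (c *\<^sub>C x)) = c * cnj c * complex_of_real (inner x x)"
    by (simp only: *) (simp add: cinner_scaleC_left cinner_scaleC_right)
  then have "complex_of_real (inner (c *\<^sub>C x) (c *\<^sub>C x)) = complex_of_real ((cmod c)\<^sup>2 * inner x x)"
    by (simp only: complex_norm_square [symmetric] of_real_mult of_real_power)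
  then have "inner (c *\<^sub>C x) (c *\<^sub>C x) = (cmod c)\<^sup>2 * inner x x"
    using of_real_eq_iff by blast
  then show ?thesis
    by (simp add: norm_eq_sqrt_inner real_sqrt_mult)
qed

lemma bounded_linear_scaleC: "bounded_linear (\<lambda>x::'a::complex_inner. c *\<^sub>C x)"
proof (rule bounded_linear_intro [of _ "cmod c"])
  show "c *\<^sub>C (r *\<^sub>R x) = r *\<^sub>R (c *\<^sub>C x)" for r and x :: 'a
    by (metis scaleC_commute scaleC_of_real)
qed (auto simp: scaleC_add_right norm_scaleC)

typedef (overloaded) ('a::complex_inner) bop =
  "{f :: 'a \<Rightarrow> 'a. bounded_linear f \<and> (\<forall>c x. f (c *\<^sub>C x) = c *\<^sub>C f x)}"
  morphisms bop_apply Bop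
  by (rule exI [of _ "\<lambda>_. 0"]) auto

setup_lifting type_definition_bop

declare [[coercion bop_apply]]

instantiation bop :: (complex_inner) ring
begin

lift_definition zero_bop :: "'a bop" is "\<lambda>_. 0"
  by auto
lift_definition plus_bop :: "'a bop \<Rightarrow> 'a bop \<Rightarrow> 'a bop" is "\<lambda>f g x. f x + g x"
  by (auto simp: bounded_linear_add scaleC_add_right)
lift_definition uminus_bop :: "'a bop \<Rightarrow> 'a bop" is "\<lambda>f x. - f x"
  by (auto simp: bounded_linear_minus scaleC_minus_right)
lift_definition minus_bop :: "'a bop \<Rightarrow> 'a bop \<Rightarrow> 'a bop" is "\<lambda>f g x. f x - g x"
  by (auto simp: bounded_linear_sub scaleC_diff_right)
lift_definition times_bop :: "'a bop \<Rightarrow> 'a bop \<Rightarrow> 'a bop" is "\<lambda>f g x. f (g x)"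
  by (auto simp: bounded_linear_compose)

instance
proof
  fix a b c :: "'a bop"
  show "a * (b + c) = a * b + a * c"
    by transfer (auto simp: linear_simps)
qed (transfer; auto simp: algebra_simps)+

end

instantiation bop :: (complex_inner) one
begin
lift_definition one_bop :: "'a bop" is "\<lambda>x. x"
  by auto
instance ..
end

instantiation bop :: (complex_inner) complex_vector
begin
lift_definition scaleC_bop :: "complex \<Rightarrow> 'a bop \<Rightarrow> 'a bop" is "\<lambda>c f x. c *\<^sub>C f x"
  using bounded_linear_compose [OF bounded_linear_scaleC] scaleC_commute by auto
instance
  by standard (transfer; simp add: scaleC_add_right scaleC_add_left scaleC_scaleC scaleC_one)+
end

definition is_adjoint :: "'a::complex_inner bop \<Rightarrow> 'a bop \<Rightarrow> bool" where
  "is_adjoint A B \<longleftrightarrow> (\<forall>x y. cinner (A x) y = cinner x (B y))"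

definition adjoint_closed :: "'a::complex_inner bop set \<Rightarrow> bool" where
  "adjoint_closed S \<longleftrightarrow> (\<forall>A\<in>S. \<exists>B\<in>S. is_adjoint A B)"

text \<open>Positivity and the Loewner order; \<open>0 \<le> z\<close> for complex \<open>z\<close> means that \<open>z\<close> is real and
  nonnegative.\<close>

definition pos_op :: "'a::complex_inner bop \<Rightarrow> bool" where
  "pos_op A \<longleftrightarrow> (\<forall>x. 0 \<le> cinner x (A x))"

definition loewner_le :: "'a::complex_inner bop \<Rightarrow> 'a bop \<Rightarrow> bool" where
  "loewner_le A B \<longleftrightarrow> pos_op (B - A)"


section \<open>Commutants and von Neumann algebras\<close>

text \<open>The ambient algebra is a parameter, because both \<open>\<B>(H)\<close> and full matrix algebras over
  \<open>\<complex>\<close> and over \<open>\<B>(H)\<close> are needed.\<close>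

definition commutant_in :: "'a::times set \<Rightarrow> 'a set \<Rightarrow> 'a set" where
  "commutant_in B A = {X \<in> B. \<forall>Y\<in>A. X * Y = Y * X}"

abbreviation commutant :: "'a::complex_inner bop set \<Rightarrow> 'a bop set" where
  "commutant \<equiv> commutant_in UNIV"

definition von_neumann_algebra :: "'a::complex_inner bop set \<Rightarrow> bool" where
  "von_neumann_algebra M \<longleftrightarrow> adjoint_closed M \<and> commutant (commutant M) = M"

text \<open>Every finite-dimensional von Neumann algebra is, up to isomorphism, a von Neumann algebra
  acting on some \<open>\<complex>\<^sup>n\<close>.\<close>

definition matrix_von_neumann_algebra :: "nat \<Rightarrow> complex mat set \<Rightarrow> bool" where
  "matrix_von_neumann_algebra n N \<longleftrightarrow>
     N \<subseteq> carrier_mat n n \<and>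
     (\<forall>y\<in>N. map_mat cnj (transpose_mat y) \<in> N) \<and>
     commutant_in (carrier_mat n n) (commutant_in (carrier_mat n n) N) = N"

text \<open>Normality is automatic in finite dimension. The condition \<open>\<tau> 1 = 1\<close> excludes \<open>n = 0\<close>.\<close>

definition faithful_tracial_state :: "nat \<Rightarrow> complex mat set \<Rightarrow> (complex mat \<Rightarrow> complex) \<Rightarrow> bool" where
  "faithful_tracial_state n N \<tau> \<longleftrightarrow>
     (\<forall>x\<in>N. \<forall>y\<in>N. \<tau> (x + y) = \<tau> x + \<tau> y) \<and>
     (\<forall>c. \<forall>x\<in>N. \<tau> (c \<cdot>\<^sub>m x) = c * \<tau> x) \<and>
     (\<forall>x\<in>N. \<forall>y\<in>N. \<tau> (x * y) = \<tau> (y * x)) \<and>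
     (\<forall>x\<in>N. 0 \<le> \<tau> (map_mat cnj (transpose_mat x) * x)) \<and>
     (\<forall>x\<in>N. \<tau> (map_mat cnj (transpose_mat x) * x) = 0 \<longrightarrow> x = 0\<^sub>m n n) \<and>
     \<tau> (1\<^sub>m n) = 1"


section \<open>Traces on \<open>\<B>(H)\<close> and orthogonal complements\<close>

text \<open>A faithful normal semifinite trace on \<open>\<B>(H)\<close>; only the values on positive operators
  matter. Up to a positive scalar this is the canonical trace, in particular the usual
  matrix trace when \<open>H\<close> is finite-dimensional.\<close>

definition fns_trace :: "('a::complex_inner bop \<Rightarrow> ennreal) \<Rightarrow> bool" where
  "fns_trace \<tau> \<longleftrightarrow>
     (\<forall>A B. pos_op A \<longrightarrow> pos_op B \<longrightarrow> \<tau> (A + B) = \<tau> A + \<tau> B) \<and>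
     (\<forall>r\<ge>0. \<forall>A. pos_op A \<longrightarrow> \<tau> (complex_of_real r *\<^sub>C A) = ennreal r * \<tau> A) \<and>
     (\<forall>A B. is_adjoint A B \<longrightarrow> \<tau> (B * A) = \<tau> (A * B)) \<and>
     (\<forall>A. pos_op A \<longrightarrow> \<tau> A = 0 \<longrightarrow> A = 0) \<and>
     (\<forall>A. pos_op A \<longrightarrow> A \<noteq> 0 \<longrightarrow> (\<exists>B. pos_op B \<and> loewner_le B A \<and> B \<noteq> 0 \<and> \<tau> B < \<infinity>)) \<and>
     (\<forall>D A. D \<noteq> {} \<longrightarrow> (\<forall>B\<in>D. pos_op B) \<longrightarrow>
        (\<forall>B\<in>D. \<forall>C\<in>D. \<exists>E\<in>D. loewner_le B E \<and> loewner_le C E) \<longrightarrow>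
        (\<forall>B\<in>D. loewner_le B A) \<longrightarrow> (\<forall>C. (\<forall>B\<in>D. loewner_le B C) \<longrightarrow> loewner_le A C) \<longrightarrow>
        \<tau> A = (SUP B\<in>D. \<tau> B))"

text \<open>The linear extension of a trace to the linear span of the positive operators of finite
  trace, as a relation.\<close>

definition has_trace :: "('a::complex_inner bop \<Rightarrow> ennreal) \<Rightarrow> 'a bop \<Rightarrow> complex \<Rightarrow> bool" where
  "has_trace \<tau> T z \<longleftrightarrow> (\<exists>A B C D.
     (\<forall>X\<in>{A, B, C, D}. pos_op X \<and> \<tau> X < \<infinity>) \<and>
     T = (A - B) + \<i> *\<^sub>C (C - D) \<and>
     z = Complex (enn2real (\<tau> A) - enn2real (\<tau> B)) (enn2real (\<tau> C) - enn2real (\<tau> D)))"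

text \<open>All \<open>X\<close> with \<open>\<tau>(Y\<^sup>* X) = 0\<close> for all \<open>Y\<close> in \<open>A\<close>. If \<open>H\<close> is infinite-dimensional, the
  condition is imposed for those \<open>Y\<close> for which the trace of \<open>Y\<^sup>* X\<close> is defined.\<close>

definition trace_complement ::
  "('a::complex_inner bop \<Rightarrow> ennreal) \<Rightarrow> 'a bop set \<Rightarrow> 'a bop set" where
  "trace_complement \<tau> A =
     {X. \<forall>Y\<in>A. \<forall>Y' z. is_adjoint Y Y' \<longrightarrow> has_trace \<tau> (Y' * X) z \<longrightarrow> z = 0}"


section \<open>Quantum graphs\<close>

text \<open>The pair \<open>(S, M)\<close> stands for the triple \<open>(S, M, \<B>(H))\<close>; the Hilbert space \<open>H\<close> is
  the type \<open>'a\<close>.\<close>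

type_synonym 'a quantum_graph = "'a bop set \<times> 'a bop set"

definition is_quantum_graph :: "'a::chilbert_space quantum_graph \<Rightarrow> bool" where
  "is_quantum_graph = (\<lambda>(S, M).
     von_neumann_algebra M \<and>
     csubspace S \<and>
     adjoint_closed S \<and>
     (\<forall>A\<in>commutant M. \<forall>X\<in>S. \<forall>B\<in>commutant M. A * X * B \<in> S) \<and>
     (\<exists>\<tau>. fns_trace \<tau> \<and> S \<subseteq> trace_complement \<tau> (commutant M)))"


section \<open>The quantum chromatic number\<close>

text \<open>\<open>\<B>(H \<otimes> \<complex>\<^sup>n)\<close> is identified with the \<open>n \<times> n\<close> matrices over \<open>\<B>(H)\<close>, so that
  \<open>X \<otimes> y\<close> has entries \<open>y\<^sub>i\<^sub>j X\<close>.\<close>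

definition tensor_mat :: "nat \<Rightarrow> 'a::complex_inner bop \<Rightarrow> complex mat \<Rightarrow> 'a bop mat" where
  "tensor_mat n X y = mat n n (\<lambda>(i, j). (y $$ (i, j)) *\<^sub>C X)"

definition vn_tensor_mat ::
  "nat \<Rightarrow> 'a::complex_inner bop set \<Rightarrow> complex mat set \<Rightarrow> 'a bop mat set" where
  "vn_tensor_mat n M N =
     commutant_in (carrier_mat n n)
       (commutant_in (carrier_mat n n) {tensor_mat n X y | X y. X \<in> M \<and> y \<in> N})"

definition self_adjoint_mat :: "nat \<Rightarrow> 'a::complex_inner bop mat \<Rightarrow> bool" where
  "self_adjoint_mat n P \<longleftrightarrow> (\<forall>i<n. \<forall>j<n. is_adjoint (P $$ (i, j)) (P $$ (j, i)))"

definition quantum_colorable :: "'a::chilbert_space quantum_graph \<Rightarrow> nat \<Rightarrow> bool" where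
  "quantum_colorable = (\<lambda>(S, M) c.
     \<exists>n N \<tau> (P :: nat \<Rightarrow> 'a bop mat).
       matrix_von_neumann_algebra n N \<and>
       faithful_tracial_state n N \<tau> \<and>
       (\<forall>a\<in>{1..c}. P a \<in> vn_tensor_mat n M N \<and> P a * P a = P a \<and> self_adjoint_mat n (P a)) \<and>
       mat n n (\<lambda>ij. \<Sum>a\<in>{1..c}. P a $$ ij) = 1\<^sub>m n \<and>
       (\<forall>X\<in>S. \<forall>a\<in>{1..c}. P a * tensor_mat n X (1\<^sub>m n) * P a = 0\<^sub>m n n))"

definition quantum_chromatic_number :: "'a::chilbert_space quantum_graph \<Rightarrow> enat" where
  "quantum_chromatic_number G = Inf {enat c | c. quantum_colorable G c}"


section \<open>The categorical product\<close>

text \<open>\<open>t\<close> exhibits \<open>'c\<close> as the Hilbert space tensor product of \<open>'a\<close> and \<open>'b\<close>; these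
  conditions determine \<open>('c, t)\<close> up to a unique unitary.\<close>

definition hilbert_tensor ::
  "('a::chilbert_space \<Rightarrow> 'b::chilbert_space \<Rightarrow> 'c::chilbert_space) \<Rightarrow> bool" where
  "hilbert_tensor t \<longleftrightarrow>
     (\<forall>a a' b. t (a + a') b = t a b + t a' b) \<and>
     (\<forall>a b b'. t a (b + b') = t a b + t a b') \<and>
     (\<forall>c a b. t (c *\<^sub>C a) b = c *\<^sub>C t a b \<and> t a (c *\<^sub>C b) = c *\<^sub>C t a b) \<and>
     (\<forall>a a' b b'. cinner (t a b) (t a' b') = cinner a a' * cinner b b') \<and>
     closure (cspan {t a b | a b. True}) = UNIV"

text \<open>The operators \<open>X \<otimes> Y\<close> with \<open>X\<close> in \<open>A\<close> and \<open>Y\<close> in \<open>B\<close>; the equation determines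
  \<open>X \<otimes> Y\<close>, since simple tensors are total.\<close>

definition op_tensors ::
  "('a::chilbert_space \<Rightarrow> 'b::chilbert_space \<Rightarrow> 'c::chilbert_space) \<Rightarrow>
    'a bop set \<Rightarrow> 'b bop set \<Rightarrow> 'c bop set" where
  "op_tensors t A B = {Z :: 'c bop. \<exists>X\<in>A. \<exists>Y\<in>B. \<forall>a b. Z (t a b) = t (X a) (Y b)}"

definition categorical_product ::
  "('a::chilbert_space \<Rightarrow> 'b::chilbert_space \<Rightarrow> 'c::chilbert_space) \<Rightarrow>
    'a quantum_graph \<Rightarrow> 'b quantum_graph \<Rightarrow> 'c quantum_graph" where
  "categorical_product t = (\<lambda>(S1, M1) (S2, M2).
     (cspan (op_tensors t S1 S2), commutant (commutant (op_tensors t M1 M2))))"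

end

theory Submission
  imports Defs
begin

text \<open>
  A colouring \<open>P\<close> of one factor, say \<open>G\<close>, induces the colouring \<open>P \<otimes> 1\<close> of the product.
  The ampliation \<open>X \<otimes> 1\<close> of an operator with an adjoint is bounded because every finite sum of
  simple tensors can be written with orthonormal second legs. That \<open>P \<otimes> 1\<close> lies in the von
  Neumann tensor product is checked against an operator \<open>T\<close> of the commutant: with
  \<open>V\<^sub>b a = a \<otimes> b\<close>, the slices \<open>V\<^bsub>b'\<^esub>\<^sup>* T V\<^sub>b\<close> commute with \<open>M\<^sub>G \<otimes> N\<close>, hence with \<open>P\<close>,
  and the slices determine \<open>T\<close>.
\<close>

section \<open>Complex inner products and bounded operators\<close>

lemma cinner_add_left: "cinner (x + y) z = cinner x z + cinner y (z::'a::complex_inner)"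
  by (metis cinner_add_right cinner_commute complex_cnj_add)

lemma norm_cinner_le: "cmod (cinner x y) \<le> norm x * norm (y::'a::complex_inner)"
proof -
  \<comment> \<open>The phase \<open>u\<close> rotates the inner product onto its modulus, which
    reduces the claim to the real Cauchy-Schwarz inequality. It is 0 when the inner product
    vanishes, hence the estimate \<open>norm (u *\<^sub>C y) \<le> norm y\<close> rather than an
    equality.\<close>
  define u where "u = cnj (sgn (cinner x y))"
  have "complex_of_real (cmod (cinner x y)) = u * cinner x y"
    by (cases "cinner x y = 0")
      (auto simp: u_def sgn_div_norm scaleR_conv_of_real complex_norm_square [symmetric]
        power2_eq_square divide_simps mult.commute)
  then have "cmod (cinner x y) = Re (cinner x (u *\<^sub>C y))"
    by (metis Re_complex_of_real cinner_scaleC_right)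
  also have "\<dots> \<le> norm x * norm (u *\<^sub>C y)"
    by (simp add: Re_cinner norm_cauchy_schwarz)
  also have "\<dots> \<le> norm x * norm y"
    by (auto simp: norm_scaleC u_def norm_sgn)
  finally show ?thesis .
qed

lemma bounded_bilinear_cinner: "bounded_bilinear (cinner :: 'a::complex_inner \<Rightarrow> 'a \<Rightarrow> complex)"
proof
  fix a a' b b' :: 'a and r :: real
  show "cinner (a + a') b = cinner a b + cinner a' b"
    by (rule cinner_add_left)
  show "cinner a (b + b') = cinner a b + cinner a b'"
    by (rule cinner_add_right)
  show "cinner (r *\<^sub>R a) b = r *\<^sub>R cinner a b"
    using cinner_scaleC_left [of "complex_of_real r" a b]
    by (simp add: scaleC_of_real scaleR_conv_of_real)
  show "cinner a (r *\<^sub>R b) = r *\<^sub>R cinner a b"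
    using cinner_scaleC_right [of a "complex_of_real r" b]
    by (simp add: scaleC_of_real scaleR_conv_of_real)
  show "\<exists>K. \<forall>x y :: 'a. cmod (cinner x y) \<le> norm x * norm y * K"
    by (intro exI [of _ 1]) (simp add: norm_cinner_le)
qed

lemmas cinner_simps [simp] =
  bounded_bilinear.zero_left [OF bounded_bilinear_cinner]
  bounded_bilinear.zero_right [OF bounded_bilinear_cinner]
lemmas cinner_diff_right = bounded_bilinear.diff_right [OF bounded_bilinear_cinner]
lemmas cinner_sum_left = bounded_bilinear.sum_left [OF bounded_bilinear_cinner]
lemmas cinner_sum_right = bounded_bilinear.sum_right [OF bounded_bilinear_cinner]
lemmas tendsto_cinner = bounded_bilinear.tendsto [OF bounded_bilinear_cinner]
lemmas continuous_on_cinner = bounded_bilinear.continuous_on [OF bounded_bilinear_cinner]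

lemma cinner_self: "cinner x x = complex_of_real ((norm (x::'a::complex_inner))\<^sup>2)"
proof -
  have "Im (cinner x x) = - Im (cinner x x)"
    using arg_cong [OF cinner_commute [of x x], of Im] by simp
  then show ?thesis
    by (simp add: complex_eq_iff Re_cinner power2_norm_eq_inner)
qed

lemma cinner_self_eq_0: "cinner x x = 0 \<longleftrightarrow> (x::'a::complex_inner) = 0"
  by (simp add: cinner_self)

lemma cinner_ext:
  assumes "\<And>x. cinner x y = cinner x (z::'a::complex_inner)"
  shows "y = z"
  using assms [of "y - z"] cinner_self_eq_0 [of "y - z"] by (simp add: cinner_diff_right)

section \<open>Complex subspaces and total sets\<close>

lemma csubspace_cspan: "csubspace (cspan A)"
  unfolding cspan_def by (rule hull_in) (auto simp: csubspace_def)

lemma cspan_minimal: "A \<subseteq> V \<Longrightarrow> csubspace V \<Longrightarrow> cspan A \<subseteq> V"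
  unfolding cspan_def by (rule hull_minimal)

lemma csubspace_diff:
  "csubspace V \<Longrightarrow> x \<in> V \<Longrightarrow> y \<in> V \<Longrightarrow> x - y \<in> (V::'a::complex_inner set)"
proof -
  assume V: "csubspace V" "x \<in> V" "y \<in> V"
  have "(- 1) *\<^sub>C y = - y"
    using scaleC_of_real [of "- 1" y] by simp
  then have "- y \<in> V"
    using V by (metis csubspace_def)
  then show ?thesis
    using V unfolding csubspace_def by (metis diff_conv_add_uminus)
qed

text \<open>A closed subspace containing \<open>A\<close> contains the closure of its span.
  Identities between continuous expressions are carried in this way from simple tensors to all
  vectors.\<close>

lemma total_closed_subspace:
  fixes V :: "'a::complex_inner set"
  assumes "closure (cspan A) = UNIV" "A \<subseteq> V" "csubspace V" "closed V"
  shows "x \<in> V"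
  using closure_minimal [OF cspan_minimal [OF assms(2,3)] assms(4)] assms(1) by auto

lemma total_cinner_ext:
  fixes y z :: "'a::complex_inner"
  assumes "closure (cspan A) = UNIV" and eq: "\<And>x. x \<in> A \<Longrightarrow> cinner x y = cinner x z"
  shows "y = z"
proof (rule cinner_ext)
  fix x
  have "x \<in> {x. cinner x y = cinner x z}"
    using assms(1)
  proof (rule total_closed_subspace)
    show "csubspace {x. cinner x y = cinner x z}"
      by (auto simp: csubspace_def cinner_add_left cinner_scaleC_left)
    show "closed {x. cinner x y = cinner x z}"
      by (intro closed_Collect_eq continuous_on_cinner continuous_intros)
  qed (use eq in auto)
  then show "cinner x y = cinner x z"
    by simp
qed

section \<open>Elementary properties of bounded operators\<close>

lemma bop_bounded_linear: "bounded_linear (bop_apply A)"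
  using bop_apply by auto

lemma bop_scaleC: "bop_apply A (c *\<^sub>C x) = c *\<^sub>C A x"
  using bop_apply by auto

lemmas bop_add = linear_simps(1) [OF bop_bounded_linear]

lemma bop_eqI: "(\<And>x. bop_apply A x = bop_apply B x) \<Longrightarrow> A = B"
  by (simp add: bop_apply_inject [symmetric] ext)

lemma bop_apply_sum: "bop_apply (\<Sum>i\<in>I. f i) x = (\<Sum>i\<in>I. bop_apply (f i) x)"
proof (induction I rule: infinite_finite_induct)
qed (simp_all add: zero_bop.rep_eq plus_bop.rep_eq)

lemma bop_mult_one: "1 * A = A" "A * 1 = (A::'a::complex_inner bop)"
  by (rule bop_eqI, simp add: times_bop.rep_eq one_bop.rep_eq)+

lemma total_bop_ext:
  fixes B C :: "'a::complex_inner bop"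
  assumes "closure (cspan A) = UNIV" and eq: "\<And>x. x \<in> A \<Longrightarrow> B x = C x"
  shows "B = C"
proof (rule bop_eqI)
  fix x
  have "x \<in> {x. B x = C x}"
    using assms(1)
  proof (rule total_closed_subspace)
    show "csubspace {x. B x = C x}"
      by (auto simp: csubspace_def bop_add bop_scaleC
          linear_simps(3) [OF bop_bounded_linear])
    show "closed {x. B x = C x}"
      by (intro closed_Collect_eq linear_continuous_on bop_bounded_linear)
  qed (use eq in auto)
  then show "B x = C x"
    by simp
qed

lemma scaleC_zero_left: "0 *\<^sub>C x = (0::'a::complex_inner)"
  using scaleC_of_real [of 0 x] by simp

lemma is_adjoint_commute: "is_adjoint A B \<Longrightarrow> is_adjoint B A"
  unfolding is_adjoint_def by (metis cinner_commute)

lemma is_adjoint_scaleC: "is_adjoint A B \<Longrightarrow> is_adjoint (c *\<^sub>C A) (cnj c *\<^sub>C B)"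
  by (simp add: is_adjoint_def scaleC_bop.rep_eq cinner_scaleC_left cinner_scaleC_right)

text \<open>Operators are obtained from their matrix coefficients \<open>cinner d (F x)\<close>, encoded as a relation
  \<open>R x (F x)\<close>, so that neither adjoints nor the Riesz representation theorem are needed.\<close>

lemma closed_relation_bounded_linear:
  fixes R :: "'a::complex_inner \<Rightarrow> 'b::chilbert_space \<Rightarrow> bool"
  assumes L: "csubspace L" "closure L = UNIV"
    and ex: "\<And>x. x \<in> L \<Longrightarrow> \<exists>y. R x y"
    and bound: "\<And>x y. x \<in> L \<Longrightarrow> R x y \<Longrightarrow> norm y \<le> K * norm x"
    and add: "\<And>x y x' y'. R x y \<Longrightarrow> R x' y' \<Longrightarrow> R (x + x') (y + y')"
    and scale: "\<And>c x y. R x y \<Longrightarrow> R (c *\<^sub>C x) (c *\<^sub>C y)"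
    and lim: "\<And>f g x y. (\<And>n. R (f n) (g n)) \<Longrightarrow> f \<longlonglongrightarrow> x \<Longrightarrow> g \<longlonglongrightarrow> y \<Longrightarrow> R x y"
  obtains F where "bounded_linear F" "\<And>c x. F (c *\<^sub>C x) = c *\<^sub>C F x" "\<And>x. R x (F x)"
proof -
  have diff: "R (x - x') (y - y')" if "R x y" "R x' y'" for x y x' y'
    using add [OF that(1) scale [OF that(2), of "- 1"]]
      scaleC_of_real [of "- 1" x'] scaleC_of_real [of "- 1" y'] by simp
  have ex_bounded: "\<exists>y. R x y \<and> norm y \<le> K * norm x" for x
  proof -
    obtain f where f: "\<And>n. f n \<in> L" "f \<longlonglongrightarrow> x"
      using L(2) closure_sequential [of x L] by auto
    obtain g where g: "\<And>n. R (f n) (g n)"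
      using ex [OF f(1)] by metis
    \<comment> \<open>\<open>R\<close> is closed under differences, so the bound on \<open>L\<close>
      controls \<open>g m - g n\<close> by \<open>f m - f n\<close>. The absolute value allows for a
      negative \<open>K\<close>.\<close>
    have dist_g: "dist (g m) (g n) \<le> \<bar>K\<bar> * dist (f m) (f n)" for m n
      using bound [OF csubspace_diff [OF L(1) f(1) f(1)] diff [OF g g], of m n]
        mult_right_mono [OF abs_ge_self norm_ge_zero, of K "f m - f n"]
      by (simp add: dist_norm)
    have "Cauchy g"
    proof (rule metric_CauchyI)
      fix e :: real
      assume "0 < e"
      then have "0 < e / (\<bar>K\<bar> + 1)"
        by simp
      with LIMSEQ_imp_Cauchy [OF f(2)] obtain M where
        M: "\<And>m n. m \<ge> M \<Longrightarrow> n \<ge> M \<Longrightarrow> dist (f m) (f n) < e / (\<bar>K\<bar> + 1)"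
        unfolding Cauchy_def by metis
      have "dist (g m) (g n) < e" if "m \<ge> M" "n \<ge> M" for m n
      proof -
        have "(\<bar>K\<bar> + 1) * dist (f m) (f n) < e"
          using M [OF that] by (simp add: field_simps)
        moreover have "\<bar>K\<bar> * dist (f m) (f n) \<le> (\<bar>K\<bar> + 1) * dist (f m) (f n)"
          by (intro mult_right_mono) auto
        ultimately show ?thesis
          using dist_g [of m n] by linarith
      qed
      then show "\<exists>M. \<forall>m\<ge>M. \<forall>n\<ge>M. dist (g m) (g n) < e"
        by blast
    qed
    then obtain y where y: "g \<longlonglongrightarrow> y"
      using Cauchy_convergent convergent_def by blast
    have "norm y \<le> K * norm x"
      by (rule LIMSEQ_le [OF tendsto_norm [OF y] tendsto_mult_left [OF tendsto_norm [OF f(2)]]])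
        (use bound [OF f(1) g] in auto)
    with lim [OF g f(2) y] show ?thesis
      by blast
  qed
  \<comment> \<open>The difference \<open>y - y'\<close> is related to \<open>0\<close>, which lies
    in \<open>L\<close>; the bound there forces it to vanish. So \<open>R\<close> is single-valued
    even at points outside \<open>L\<close>.\<close>
  have unique: "y = y'" if "R x y" "R x y'" for x y y'
    using bound [OF _ diff [OF that]] L(1) by (simp add: csubspace_def)
  obtain F where F: "\<And>x. R x (F x)" "\<And>x. norm (F x) \<le> K * norm x"
    using ex_bounded by metis
  have F_add: "F (x + y) = F x + F y" for x y
    using unique [OF F(1) add [OF F(1) F(1)]] .
  have F_scale: "F (c *\<^sub>C x) = c *\<^sub>C F x" for c x
    using unique [OF F(1) scale [OF F(1)]] .
  have "bounded_linear F"
  proof (rule bounded_linear_intro)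
    show "F (r *\<^sub>R x) = r *\<^sub>R F x" for r x
      using F_scale [of "complex_of_real r" x] by (simp add: scaleC_of_real)
    show "norm (F x) \<le> norm x * K" for x
      using F(2) by (simp add: mult.commute)
  qed (rule F_add)
  then show ?thesis
    using that F(1) F_scale by blast
qed


section \<open>Ampliations and slices\<close>

text \<open>The operator \<open>X\<close> \<otimes> 1, given by its values on simple tensors, which
  determine it by totality. It is a relation because existence is a separate matter, settled for
  operators that have an adjoint.\<close>

definition ampliation ::
  "('a::chilbert_space \<Rightarrow> 'b::chilbert_space \<Rightarrow> 'c::chilbert_space) \<Rightarrow> 'a bop \<Rightarrow> 'c bop \<Rightarrow> bool" where
  "ampliation t X Z \<longleftrightarrow> (\<forall>a b. Z (t a b) = t (X a) b)"

definition orthonormal :: "'a::complex_inner set \<Rightarrow> bool" where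
  "orthonormal E \<longleftrightarrow> finite E \<and> (\<forall>e\<in>E. \<forall>e'\<in>E. cinner e e' = (if e = e' then 1 else 0))"

text \<open>One step of Gram-Schmidt: the residual of \<open>b\<close> after projection onto the
  span of \<open>E\<close> is either zero or, once normalised, the element to be added.\<close>

lemma orthonormal_extend:
  fixes b :: "'a::complex_inner"
  assumes E: "orthonormal E"
  obtains E' \<beta> where "orthonormal E'" "E \<subseteq> E'" "b = (\<Sum>e\<in>E'. \<beta> e *\<^sub>C e)"
proof -
  define r where "r = b - (\<Sum>e\<in>E. cinner e b *\<^sub>C e)"
  have fin: "finite E"
    using E by (simp add: orthonormal_def)
  have ortho: "cinner e r = 0" if "e \<in> E" for e
  proof -
    have "(\<Sum>e'\<in>E. cinner e (cinner e' b *\<^sub>C e')) = (\<Sum>e'\<in>E. if e' = e then cinner e b else 0)"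
      by (rule sum.cong) (use E that in \<open>auto simp: orthonormal_def cinner_scaleC_right\<close>)
    then show ?thesis
      using fin that by (simp add: r_def cinner_diff_right cinner_sum_right)
  qed
  show ?thesis
  proof (cases "r = 0")
    case True
    then show ?thesis
      using that [OF E order_refl, of "\<lambda>e. cinner e b"] by (simp add: r_def)
  next
    case False
    define u where "u = complex_of_real (inverse (norm r)) *\<^sub>C r"
    have u: "cinner u u = 1" "\<And>e. e \<in> E \<Longrightarrow> cinner e u = 0"
      using False ortho by (auto simp: u_def cinner_self norm_scaleC norm_inverse cinner_scaleC_right)
    then have u': "\<And>e. e \<in> E \<Longrightarrow> cinner u e = 0"
      by (metis cinner_commute complex_cnj_zero)
    have "u \<notin> E"
      using u by fastforce
    have r: "r = complex_of_real (norm r) *\<^sub>C u"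
      using False by (simp add: u_def scaleC_scaleC scaleC_one flip: of_real_mult)
    \<comment> \<open>Only the new vector \<open>u\<close> receives the coefficient
      \<open>norm r\<close>; the old coefficients survive because \<open>u\<close> is outside
      \<open>E\<close>.\<close>
    have "(\<Sum>e\<in>E. (if e = u then complex_of_real (norm r) else cinner e b) *\<^sub>C e)
        = (\<Sum>e\<in>E. cinner e b *\<^sub>C e)"
      by (rule sum.cong) (use \<open>u \<notin> E\<close> in auto)
    then have "b = (\<Sum>e\<in>insert u E. (if e = u then complex_of_real (norm r) else cinner e b) *\<^sub>C e)"
      using fin \<open>u \<notin> E\<close> by (simp add: r [symmetric]) (simp add: r_def)
    moreover have "orthonormal (insert u E)"
      using E u u' unfolding orthonormal_def by auto
    ultimately show ?thesis
      by (intro that [of "insert u E"]) auto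
  qed
qed

context
  fixes t :: "'a::chilbert_space \<Rightarrow> 'b::chilbert_space \<Rightarrow> 'c::chilbert_space"
  assumes ht: "hilbert_tensor t"
begin

abbreviation (input) simple_tensors :: "'c set" where
  "simple_tensors \<equiv> {t a b | a b. True}"

section \<open>Elementary properties of the tensor map\<close>

lemma tensor_add_left: "t (a + a') b = t a b + t a' b"
  and tensor_add_right: "t a (b + b') = t a b + t a b'"
  and tensor_scaleC_left: "t (c *\<^sub>C a) b = c *\<^sub>C t a b"
  and tensor_scaleC_right: "t a (c *\<^sub>C b) = c *\<^sub>C t a b"
  and cinner_tensor: "cinner (t a b) (t a' b') = cinner a a' * cinner b b'"
  and total_simple_tensors: "closure (cspan simple_tensors) = UNIV"
  using ht by (auto simp: hilbert_tensor_def)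

lemma norm_tensor: "norm (t a b) = norm a * norm b"
proof -
  have "complex_of_real ((norm (t a b))\<^sup>2) = complex_of_real ((norm a * norm b)\<^sup>2)"
    using cinner_tensor [of a b a b] by (simp add: cinner_self power_mult_distrib)
  then show ?thesis
    by (metis mult_nonneg_nonneg norm_ge_zero of_real_eq_iff power2_eq_imp_eq)
qed

lemma bounded_linear_tensor_left: "bounded_linear (\<lambda>a. t a b)"
proof (rule bounded_linear_intro)
  show "t (r *\<^sub>R a) b = r *\<^sub>R t a b" for r a
    using tensor_scaleC_left [of "complex_of_real r" a b] by (simp add: scaleC_of_real)
qed (auto simp: tensor_add_left norm_tensor)

lemma bounded_linear_tensor_right: "bounded_linear (\<lambda>b. t a b)"
proof (rule bounded_linear_intro)
  show "t a (r *\<^sub>R b) = r *\<^sub>R t a b" for r b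
    using tensor_scaleC_right [of a "complex_of_real r" b] by (simp add: scaleC_of_real)
  show "norm (t a b) \<le> norm b * norm a" for b
    by (simp add: norm_tensor)
qed (auto simp: tensor_add_right)

lemmas tensor_zero_left = linear_simps(3) [OF bounded_linear_tensor_left]
lemmas tensor_sum_left = linear_sum [OF bounded_linear.linear [OF bounded_linear_tensor_left]]
lemmas tensor_sum_right = linear_sum [OF bounded_linear.linear [OF bounded_linear_tensor_right]]

lemma tensor_bop_ext: "(\<And>a b. bop_apply B (t a b) = bop_apply C (t a b)) \<Longrightarrow> B = C"
  using total_bop_ext [OF total_simple_tensors, of B C] by blast

lemma tensor_cinner_ext: "(\<And>a b. cinner (t a b) y = cinner (t a b) z) \<Longrightarrow> y = z"
  using total_cinner_ext [OF total_simple_tensors, of y z] by blast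

section \<open>Finite tensors with orthonormal second legs\<close>

lemma cspan_simple_tensors_orthonormal:
  assumes "z \<in> cspan simple_tensors"
  obtains E f where "orthonormal E" "z = (\<Sum>e\<in>E. t (f e) e)"
proof -
  \<comment> \<open>The induction is strengthened: \<open>z\<close> can be absorbed into any given
    orthonormal expansion after enlarging its orthonormal set. Unlike mere existence of an
    expansion, this chains under sums, since the set obtained for one summand is the starting point
    for the other.\<close>
  define V where "V = {z. \<forall>E f. orthonormal E \<longrightarrow> (\<exists>E' f'. orthonormal E' \<and> E \<subseteq> E' \<and>
     z + (\<Sum>e\<in>E. t (f e) e) = (\<Sum>e\<in>E'. t (f' e) e))}"
  \<comment> \<open>Quantifying over all multiples builds closure under scalars into the set, so
    that \<open>V\<close> itself has to be closed under sums only.\<close>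
  have "cspan simple_tensors \<subseteq> {z. \<forall>c. c *\<^sub>C z \<in> V}"
  proof (rule cspan_minimal)
    have "t a b \<in> V" for a b
      unfolding V_def
    proof (intro CollectI allI impI)
      fix E and f :: "'b \<Rightarrow> 'a"
      assume "orthonormal (E :: 'b set)"
      then obtain E' \<beta> where E': "orthonormal E'" "E \<subseteq> E'" "b = (\<Sum>e\<in>E'. \<beta> e *\<^sub>C e)"
        using orthonormal_extend by blast
      \<comment> \<open>First legs are padded with 0 on the new elements, so that both expansions
        run over \<open>E'\<close> and can be added legwise.\<close>
      have "(\<Sum>e\<in>E. t (f e) e) = (\<Sum>e\<in>E'. t (if e \<in> E then f e else 0) e)"
        by (rule sum.mono_neutral_cong_left)
          (use E' in \<open>auto simp: orthonormal_def tensor_zero_left\<close>)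
      moreover have "t a b = (\<Sum>e\<in>E'. t (\<beta> e *\<^sub>C a) e)"
        by (subst E'(3)) (simp add: tensor_sum_right tensor_scaleC_left tensor_scaleC_right)
      ultimately have "t a b + (\<Sum>e\<in>E. t (f e) e)
          = (\<Sum>e\<in>E'. t (\<beta> e *\<^sub>C a + (if e \<in> E then f e else 0)) e)"
        by (simp only: tensor_add_left sum.distrib)
      with E'(1,2) show "\<exists>E' f'. orthonormal E' \<and> E \<subseteq> E' \<and>
          t a b + (\<Sum>e\<in>E. t (f e) e) = (\<Sum>e\<in>E'. t (f' e) e)"
        by (intro exI conjI)
    qed
    then show "simple_tensors \<subseteq> {z. \<forall>c. c *\<^sub>C z \<in> V}"
      by (auto simp: tensor_scaleC_left [symmetric])
    have "x + y \<in> V" if x: "x \<in> V" and y: "y \<in> V" for x y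
      unfolding V_def
    proof (intro CollectI allI impI)
      fix E and f :: "'b \<Rightarrow> 'a"
      assume "orthonormal (E :: 'b set)"
      with y obtain E1 f1 where 1: "orthonormal E1" "E \<subseteq> E1"
        "y + (\<Sum>e\<in>E. t (f e) e) = (\<Sum>e\<in>E1. t (f1 e) e)"
        unfolding V_def by blast
      with x obtain E2 f2 where 2: "orthonormal E2" "E1 \<subseteq> E2"
        "x + (\<Sum>e\<in>E1. t (f1 e) e) = (\<Sum>e\<in>E2. t (f2 e) e)"
        unfolding V_def by blast
      have "x + y + (\<Sum>e\<in>E. t (f e) e) = (\<Sum>e\<in>E2. t (f2 e) e)"
        using 1(3) 2(3) by (simp add: add.assoc)
      with 1 2 show "\<exists>E' f'. orthonormal E' \<and> E \<subseteq> E' \<and>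
          x + y + (\<Sum>e\<in>E. t (f e) e) = (\<Sum>e\<in>E'. t (f' e) e)"
        by blast
    qed
    moreover have "0 \<in> V"
      by (auto simp: V_def)
    ultimately show "csubspace {z. \<forall>c. c *\<^sub>C z \<in> V}"
      by (auto simp: csubspace_def scaleC_add_right scaleC_scaleC)
  qed
  then have "z \<in> V"
    using assms scaleC_one [of z] by (metis (mono_tags, lifting) mem_Collect_eq subsetD)
  \<comment> \<open>The claim is the case where \<open>z\<close> is absorbed into the empty
    expansion.\<close>
  then have "\<forall>f. orthonormal ({} :: 'b set) \<longrightarrow> (\<exists>E' f'. orthonormal E' \<and> {} \<subseteq> E' \<and>
      z + (\<Sum>e\<in>{}. t (f e) e) = (\<Sum>e\<in>E'. t (f' e) e))"
    unfolding V_def by blast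
  moreover have "orthonormal ({} :: 'b set)"
    by (simp add: orthonormal_def)
  ultimately have "\<exists>E' f'. orthonormal E' \<and> z = (\<Sum>e\<in>E'. t (f' e) e)"
    by simp
  then show ?thesis
    using that by blast
qed

text \<open>Inner products of simple tensors factor, and orthonormal second legs kill the cross
  terms: this is Pythagoras.\<close>

lemma norm_orthonormal_tensor_sum:
  assumes E: "orthonormal E"
  shows "(norm (\<Sum>e\<in>E. t (f e) e))\<^sup>2 = (\<Sum>e\<in>E. (norm (f e))\<^sup>2)"
proof -
  have "cinner (\<Sum>e\<in>E. t (f e) e) (\<Sum>e\<in>E. t (f e) e)
      = (\<Sum>e\<in>E. \<Sum>e'\<in>E. cinner (f e) (f e') * cinner e e')"
    by (simp only: cinner_sum_left cinner_sum_right [of "t _ _"] cinner_tensor)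
  also have "\<dots> = (\<Sum>e\<in>E. \<Sum>e'\<in>E. if e' = e then cinner (f e) (f e) else 0)"
    using E by (intro sum.cong refl) (auto simp: orthonormal_def)
  also have "\<dots> = (\<Sum>e\<in>E. complex_of_real ((norm (f e))\<^sup>2))"
    using E by (intro sum.cong refl) (auto simp: orthonormal_def cinner_self)
  finally show ?thesis
    by (metis cinner_self of_real_eq_iff of_real_sum)
qed

section \<open>Ampliations and their adjoints\<close>

text \<open>Applying \<open>X\<close> to the first legs over orthonormal second legs enlarges the
  norm by at most the bound of \<open>X\<close>. The map is thus bounded on the span of the simple
  tensors and extends by density; the adjoint makes it well defined there.\<close>

lemma ampliation_exists:
  assumes adj: "is_adjoint X X'"
  obtains Z where "ampliation t X Z"
proof -
  have adj': "cinner (X' x) y = cinner x (X y)" for x y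
    using is_adjoint_commute [OF adj] by (simp add: is_adjoint_def)
  \<comment> \<open>\<open>R z w\<close> says that \<open>w\<close> has the matrix coefficients
    required of (\<open>X\<close> \<otimes> 1) \<open>z\<close>. With \<open>X\<close> moved to the
    other side as \<open>X'\<close>, the relation is visibly linear and closed, and totality makes
    \<open>w\<close> unique.\<close>
  define R where "R z w \<longleftrightarrow> (\<forall>c d. cinner (t c d) w = cinner (t (X' c) d) z)" for z w
  have R_tensor: "R (t a b) (t (X a) b)" for a b
    by (simp add: R_def cinner_tensor adj')
  have R_add: "R (x + x') (y + y')" if "R x y" "R x' y'" for x y x' y'
    using that by (simp add: R_def cinner_add_right)
  have R_scale: "R (c *\<^sub>C x) (c *\<^sub>C y)" if "R x y" for c x y
    using that by (simp add: R_def cinner_scaleC_right)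
  have R_zero: "R 0 0"
    by (simp add: R_def)
  have R_sum: "R (\<Sum>i\<in>I. f i) (\<Sum>i\<in>I. g i)" if "\<And>i. i \<in> I \<Longrightarrow> R (f i) (g i)" for I :: "'b set" and f g
    using that by (induction I rule: infinite_finite_induct) (auto simp: R_zero R_add)
  have R_unique: "y = y'" if "R x y" "R x y'" for x y y'
    by (rule tensor_cinner_ext) (use that in \<open>auto simp: R_def\<close>)
  obtain K where K: "K \<ge> 0" "\<And>a. norm (X a) \<le> norm a * K"
    using bounded_linear.nonneg_bounded [OF bop_bounded_linear] by blast
  obtain F where F: "bounded_linear F" "\<And>c x. F (c *\<^sub>C x) = c *\<^sub>C F x" "\<And>x. R x (F x)"
  proof (rule closed_relation_bounded_linear [of "cspan simple_tensors" R K])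
    show "csubspace (cspan simple_tensors)"
      by (rule csubspace_cspan)
    show "closure (cspan simple_tensors) = UNIV"
      by (rule total_simple_tensors)
    have "cspan simple_tensors \<subseteq> {x. \<exists>y. R x y}"
      by (rule cspan_minimal)
        (use R_tensor R_zero R_add R_scale in \<open>auto simp: csubspace_def\<close>, blast+)
    then show "\<exists>y. R x y" if "x \<in> cspan simple_tensors" for x
      using that by blast
    show "norm y \<le> K * norm x" if x: "x \<in> cspan simple_tensors" and y: "R x y" for x y
    proof -
      obtain E f where E: "orthonormal E" "x = (\<Sum>e\<in>E. t (f e) e)"
        using cspan_simple_tensors_orthonormal [OF x] .
      \<comment> \<open>By uniqueness, \<open>y\<close> can be computed from whichever expansion of
        \<open>x\<close> is convenient, here the orthonormal one.\<close>
      have "y = (\<Sum>e\<in>E. t (X (f e)) e)"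
        using R_unique [OF y] R_sum [of E "\<lambda>e. t (f e) e" "\<lambda>e. t (X (f e)) e"] R_tensor E(2)
        by simp
      then have "(norm y)\<^sup>2 = (\<Sum>e\<in>E. (norm (X (f e)))\<^sup>2)"
        by (simp add: norm_orthonormal_tensor_sum [OF E(1), of "\<lambda>e. X (f e)"])
      also have "\<dots> \<le> (\<Sum>e\<in>E. (norm (f e) * K)\<^sup>2)"
        by (intro sum_mono power_mono K(2)) simp
      also have "\<dots> = (norm x * K)\<^sup>2"
        unfolding E(2) power_mult_distrib norm_orthonormal_tensor_sum [OF E(1)]
        by (rule sum_distrib_right [symmetric])
      finally have "(norm y)\<^sup>2 \<le> (norm x * K)\<^sup>2" .
      then have "norm y \<le> norm x * K"
        by (rule power2_le_imp_le) (simp add: K(1))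
      then show ?thesis
        by (simp add: mult.commute)
    qed
    show "R x y" if "\<And>n. R (f n) (g n)" "f \<longlonglongrightarrow> x" "g \<longlonglongrightarrow> y" for f g x y
      unfolding R_def
    proof (intro allI)
      fix c d
      have "(\<lambda>n. cinner (t c d) (g n)) \<longlonglongrightarrow> cinner (t c d) y"
        by (intro tendsto_cinner tendsto_const that)
      moreover have "(\<lambda>n. cinner (t (X' c) d) (f n)) \<longlonglongrightarrow> cinner (t (X' c) d) x"
        by (intro tendsto_cinner tendsto_const that)
      ultimately show "cinner (t c d) y = cinner (t (X' c) d) x"
        using that(1) by (simp add: R_def LIMSEQ_unique)
    qed
  qed (use R_add R_scale in auto)
  have "bop_apply (Bop F) = F"
    using F by (intro Bop_inverse) auto
  then have "ampliation t X (Bop F)"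
    unfolding ampliation_def using R_unique [OF F(3) R_tensor] by simp
  then show ?thesis
    using that by blast
qed

text \<open>For simple tensors \<open>w\<close> this is the product formula for inner products, and
  density gives the rest. It moves an ampliation across an inner product without referring to an
  ampliation of \<open>X'\<close>.\<close>

lemma ampliation_cinner:
  assumes Z: "ampliation t X Z" and adj: "is_adjoint X X'"
  shows "cinner (t a b) (Z w) = cinner (t (X' a) b) w"
proof -
  have "w \<in> {w. cinner (t a b) (Z w) = cinner (t (X' a) b) w}"
    using total_simple_tensors
  proof (rule total_closed_subspace)
    show "csubspace {w. cinner (t a b) (Z w) = cinner (t (X' a) b) w}"
      by (auto simp: csubspace_def bop_add bop_scaleC cinner_add_right cinner_scaleC_right
          linear_simps(3) [OF bop_bounded_linear])
    show "closed {w. cinner (t a b) (Z w) = cinner (t (X' a) b) w}"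
      by (intro closed_Collect_eq continuous_on_cinner continuous_intros
          linear_continuous_on bop_bounded_linear)
    show "simple_tensors \<subseteq> {w. cinner (t a b) (Z w) = cinner (t (X' a) b) w}"
      using Z is_adjoint_commute [OF adj]
      by (auto simp: ampliation_def cinner_tensor is_adjoint_def)
  qed
  then show ?thesis
    by simp
qed

text \<open>Density is used once in each vector: in \<open>x\<close> here, and in \<open>y\<close>
  through \<open>ampliation_cinner\<close> for \<open>X'\<close>.\<close>

lemma ampliation_is_adjoint:
  assumes "ampliation t X Z" "ampliation t X' Z'" "is_adjoint X X'"
  shows "is_adjoint Z Z'"
  unfolding is_adjoint_def
proof (intro allI)
  fix x y
  have "x \<in> {x. cinner (Z x) y = cinner x (Z' y)}"
    using total_simple_tensors
  proof (rule total_closed_subspace)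
    show "csubspace {x. cinner (Z x) y = cinner x (Z' y)}"
      by (auto simp: csubspace_def bop_add bop_scaleC cinner_add_left cinner_scaleC_left
          linear_simps(3) [OF bop_bounded_linear])
    show "closed {x. cinner (Z x) y = cinner x (Z' y)}"
      by (intro closed_Collect_eq continuous_on_cinner continuous_intros
          linear_continuous_on bop_bounded_linear)
    show "simple_tensors \<subseteq> {x. cinner (Z x) y = cinner x (Z' y)}"
      using assms(1) ampliation_cinner [OF assms(2) is_adjoint_commute [OF assms(3)]]
      by (auto simp: ampliation_def)
  qed
  then show "cinner (Z x) y = cinner x (Z' y)"
    by simp
qed

section \<open>Slices of operators on the tensor product\<close>

text \<open>With \<open>V b a = t a b\<close>, the slice is the adjoint of \<open>V b'\<close>
  composed with \<open>T\<close> and \<open>V b\<close>. Only that adjoint has to be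
  constructed.\<close>

lemma slice_exists:
  obtains S :: "'a bop"
  where "\<And>a a'. cinner a' (S a) = cinner (t a' b') (bop_apply T (t a b))"
proof -
  \<comment> \<open>\<open>R z w\<close> says that \<open>w\<close> is the image of \<open>z\<close>
    under the adjoint of a \<mapsto> \<open>t a b'\<close>; on simple tensors this image is
    explicit.\<close>
  define R where "R z w \<longleftrightarrow> (\<forall>a. cinner a w = cinner (t a b') z)" for z w
  have R_add: "R (x + x') (y + y')" if "R x y" "R x' y'" for x y x' y'
    using that by (simp add: R_def cinner_add_right)
  have R_scale: "R (c *\<^sub>C x) (c *\<^sub>C y)" if "R x y" for c x y
    using that by (simp add: R_def cinner_scaleC_right)
  have R_tensor: "R (t x y) (cinner b' y *\<^sub>C x)" for x y
    by (simp add: R_def cinner_tensor cinner_scaleC_right)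
  have R_zero: "R 0 0"
    by (simp add: R_def)
  obtain F where F: "bounded_linear F" "\<And>c x. F (c *\<^sub>C x) = c *\<^sub>C F x" "\<And>x. R x (F x)"
  proof (rule closed_relation_bounded_linear [of "cspan simple_tensors" R "norm b'"])
    show "csubspace (cspan simple_tensors)"
      by (rule csubspace_cspan)
    show "closure (cspan simple_tensors) = UNIV"
      by (rule total_simple_tensors)
    have "cspan simple_tensors \<subseteq> {x. \<exists>y. R x y}"
      by (rule cspan_minimal)
        (use R_tensor R_zero R_add R_scale in \<open>auto simp: csubspace_def\<close>, blast+)
    then show "\<exists>y. R x y" if "x \<in> cspan simple_tensors" for x
      using that by blast
    show "norm y \<le> norm b' * norm x" if "R x y" for x y
    proof -
      \<comment> \<open>Testing the relation against \<open>y\<close> itself and applying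
        Cauchy-Schwarz leaves a factor \<open>norm y\<close> on both sides, which cancels unless
        \<open>y = 0\<close>.\<close>
      have "norm y * norm y = cmod (cinner y y)"
        by (simp add: cinner_self power2_eq_square norm_mult)
      also have "\<dots> \<le> norm (t y b') * norm x"
        using that norm_cinner_le by (simp add: R_def)
      finally have "norm y * norm y \<le> norm y * (norm b' * norm x)"
        by (simp add: norm_tensor mult.assoc)
      then show ?thesis
        by (cases "y = 0") auto
    qed
    show "R x y" if "\<And>n. R (f n) (g n)" "f \<longlonglongrightarrow> x" "g \<longlonglongrightarrow> y" for f g x y
      unfolding R_def
    proof (intro allI)
      fix a
      have "(\<lambda>n. cinner a (g n)) \<longlonglongrightarrow> cinner a y"
        by (intro tendsto_cinner tendsto_const that)
      moreover have "(\<lambda>n. cinner (t a b') (f n)) \<longlonglongrightarrow> cinner (t a b') x"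
        by (intro tendsto_cinner tendsto_const that)
      ultimately show "cinner a y = cinner (t a b') x"
        using that(1) by (simp add: R_def LIMSEQ_unique)
    qed
  qed (use R_add R_scale in auto)
  have "bounded_linear (\<lambda>a. F (T (t a b)))"
    using bounded_linear_compose [OF F(1) bounded_linear_compose
        [OF bop_bounded_linear bounded_linear_tensor_left]] .
  then have "bop_apply (Bop (\<lambda>a. F (T (t a b)))) = (\<lambda>a. F (T (t a b)))"
    by (intro Bop_inverse) (simp add: tensor_scaleC_left bop_scaleC F(2))
  then show ?thesis
    using that [of "Bop (\<lambda>a. F (T (t a b)))"] F(3) by (simp add: R_def)
qed

end


section \<open>Colourings of the product\<close>

lemma mat_mult_index:
  assumes "A \<in> carrier_mat n n" "B \<in> carrier_mat n n" "i < n" "j < n"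
  shows "(A * B) $$ (i, j) = (\<Sum>k<n. A $$ (i, k) * B $$ (k, j))"
  using assms by (auto simp: scalar_prod_def lessThan_atLeast0 intro!: sum.cong)

text \<open>Entrywise ampliation, under the identification of operator matrices with operators on
  the tensor product with \<complex>\<open>\<^sup>n\<close>. Adjoints of the entries are included so
  that \<open>ampliation_cinner\<close> applies to each of them.\<close>

definition ampliation_mat ::
  "('a::chilbert_space \<Rightarrow> 'b::chilbert_space \<Rightarrow> 'c::chilbert_space) \<Rightarrow> nat \<Rightarrow>
    'a bop mat \<Rightarrow> 'c bop mat \<Rightarrow> bool" where
  "ampliation_mat t n A A' \<longleftrightarrow> A \<in> carrier_mat n n \<and> A' \<in> carrier_mat n n \<and>
     (\<forall>i<n. \<forall>j<n. ampliation t (A $$ (i, j)) (A' $$ (i, j)) \<and> (\<exists>X'. is_adjoint (A $$ (i, j)) X'))"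

definition slice_mat ::
  "('a::chilbert_space \<Rightarrow> 'b::chilbert_space \<Rightarrow> 'c::chilbert_space) \<Rightarrow> nat \<Rightarrow>
    'b \<Rightarrow> 'b \<Rightarrow> 'c bop mat \<Rightarrow> 'a bop mat \<Rightarrow> bool" where
  "slice_mat t n b' b T S \<longleftrightarrow> S \<in> carrier_mat n n \<and>
     (\<forall>i<n. \<forall>j<n. \<forall>a a'. cinner a' ((S $$ (i, j)) a) = cinner (t a' b') ((T $$ (i, j)) (t a b)))"

lemma slice_mat_exists:
  assumes "hilbert_tensor t"
  obtains S where "slice_mat t n b' b T S"
proof -
  have "\<exists>S. \<forall>a a'. cinner a' (bop_apply S a) = cinner (t a' b') ((T $$ ij) (t a b))" for ij
    using slice_exists [OF assms] by metis
  then obtain S where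
    "\<And>ij a a'. cinner a' (bop_apply (S ij) a) = cinner (t a' b') ((T $$ ij) (t a b))"
    by metis
  then have "slice_mat t n b' b T (mat n n S)"
    by (simp add: slice_mat_def)
  then show ?thesis
    using that by blast
qed

text \<open>Slicing is a bimodule map over ampliations. A left factor \<open>A'\<close> passes to
  the first argument of the inner product through adjoints of its entries; a right factor acts
  directly on the first leg of \<open>t a b\<close>.\<close>

lemma slice_mat_mult:
  assumes ht: "hilbert_tensor t" and A: "ampliation_mat t n A A'"
    and T: "T \<in> carrier_mat n n" and S: "slice_mat t n b' b T S" and ij: "i < n" "j < n"
  shows "cinner (t a' b') (((A' * T) $$ (i, j)) (t a b)) = cinner a' (((A * S) $$ (i, j)) a)"
    and "cinner (t a' b') (((T * A') $$ (i, j)) (t a b)) = cinner a' (((S * A) $$ (i, j)) a)"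
proof -
  note carriers = A [unfolded ampliation_mat_def, THEN conjunct1]
    A [unfolded ampliation_mat_def, THEN conjunct2, THEN conjunct1] T
    S [unfolded slice_mat_def, THEN conjunct1]
  have "cinner (t a' b') ((A' $$ (i, k)) ((T $$ (k, j)) (t a b)))
      = cinner a' ((A $$ (i, k)) ((S $$ (k, j)) a))" if k: "k < n" for k
  proof -
    obtain X' where X': "is_adjoint (A $$ (i, k)) X'"
      using A ij k unfolding ampliation_mat_def by metis
    have "cinner (t a' b') ((A' $$ (i, k)) ((T $$ (k, j)) (t a b)))
        = cinner (t (X' a') b') ((T $$ (k, j)) (t a b))"
      using A ij that by (intro ampliation_cinner [OF ht _ X']) (auto simp: ampliation_mat_def)
    also have "\<dots> = cinner (X' a') ((S $$ (k, j)) a)"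
      using S ij that by (simp add: slice_mat_def)
    finally show ?thesis
      using is_adjoint_commute [OF X'] by (simp add: is_adjoint_def)
  qed
  then show "cinner (t a' b') (((A' * T) $$ (i, j)) (t a b)) = cinner a' (((A * S) $$ (i, j)) a)"
    by (simp add: mat_mult_index [OF _ _ ij] carriers bop_apply_sum cinner_sum_right
        times_bop.rep_eq)
  show "cinner (t a' b') (((T * A') $$ (i, j)) (t a b)) = cinner a' (((S * A) $$ (i, j)) a)"
    using A S ij
    by (simp add: mat_mult_index [OF _ _ ij] carriers bop_apply_sum cinner_sum_right
        times_bop.rep_eq ampliation_mat_def slice_mat_def ampliation_def)
qed

lemma slice_mat_commute:
  assumes ht: "hilbert_tensor t" and A: "ampliation_mat t n A A'"
    and T: "T \<in> carrier_mat n n" and S: "slice_mat t n b' b T S" and comm: "A' * T = T * A'"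
  shows "A * S = S * A"
proof (rule eq_matI)
  have carriers: "A \<in> carrier_mat n n" "S \<in> carrier_mat n n"
    using A S by (auto simp: ampliation_mat_def slice_mat_def)
  fix i j
  assume "i < dim_row (S * A)" "j < dim_col (S * A)"
  then have ij: "i < n" "j < n"
    using carriers by auto
  show "(A * S) $$ (i, j) = (S * A) $$ (i, j)"
    by (rule bop_eqI, rule cinner_ext) (simp add: comm flip: slice_mat_mult [OF ht A T S ij])
qed (use A S in \<open>auto simp: ampliation_mat_def slice_mat_def\<close>)

text \<open>Matrix coefficients between simple tensors are coefficients of slices, so slices
  separate operators. This lifts commutation from the slices to \<open>T\<close>, conversely to
  \<open>slice_mat_commute\<close>.\<close>

lemma ampliation_mat_commute:
  assumes ht: "hilbert_tensor t" and A: "ampliation_mat t n A A'"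
    and T: "T \<in> carrier_mat n n"
    and comm: "\<And>b' b S. slice_mat t n b' b T S \<Longrightarrow> A * S = S * A"
  shows "A' * T = T * A'"
proof (rule eq_matI)
  have carriers: "A' \<in> carrier_mat n n"
    using A by (auto simp: ampliation_mat_def)
  fix i j
  assume "i < dim_row (T * A')" "j < dim_col (T * A')"
  then have ij: "i < n" "j < n"
    using carriers T by auto
  show "(A' * T) $$ (i, j) = (T * A') $$ (i, j)"
  proof (rule tensor_bop_ext [OF ht], rule tensor_cinner_ext [OF ht])
    fix a b a' b'
    obtain S where S: "slice_mat t n b' b T S"
      using slice_mat_exists [OF ht] .
    show "cinner (t a' b') (((A' * T) $$ (i, j)) (t a b))
        = cinner (t a' b') (((T * A') $$ (i, j)) (t a b))"
      by (simp add: slice_mat_mult [OF ht A T S ij] comm [OF S] flip: times_bop.rep_eq)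
  qed
qed (use A T in \<open>auto simp: ampliation_mat_def\<close>)

section \<open>Membership in the von Neumann tensor product\<close>

lemma commutant_in_double: "A \<subseteq> B \<Longrightarrow> A \<subseteq> commutant_in B (commutant_in B A)"
  by (auto simp: commutant_in_def)

lemma one_in_von_neumann_algebra:
  assumes "von_neumann_algebra M"
  shows "1 \<in> M"
proof -
  have "1 \<in> commutant (commutant M)"
    by (simp add: commutant_in_def bop_mult_one)
  then show ?thesis
    using assms by (simp only: von_neumann_algebra_def)
qed

text \<open>A \<open>T\<close> in the commutant of the product generators commutes in particular
  with the ampliated generators of the first factor. Its slices then commute with the generators
  themselves, hence with \<open>A\<close> by the double commutant, and this lifts back to
  \<open>A'\<close> and \<open>T\<close>.\<close>

lemma ampliation_in_vn_tensor_mat: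
  assumes ht: "hilbert_tensor t" and A: "ampliation_mat t n A A'"
    and M1: "von_neumann_algebra M1" and M2: "von_neumann_algebra M2"
    and A_in: "A \<in> vn_tensor_mat n M1 N"
  shows "A' \<in> vn_tensor_mat n (commutant (commutant (op_tensors t M1 M2))) N"
proof -
  let ?M = "commutant (commutant (op_tensors t M1 M2))"
  have "A' * T = T * A'"
    if T: "T \<in> commutant_in (carrier_mat n n) {tensor_mat n Z y | Z y. Z \<in> ?M \<and> y \<in> N}" for T
  proof (rule ampliation_mat_commute [OF ht A])
    show Tc: "T \<in> carrier_mat n n"
      using T by (simp add: commutant_in_def)
    fix b' b S
    assume S: "slice_mat t n b' b T S"
    have "S * tensor_mat n X y = tensor_mat n X y * S" if X: "X \<in> M1" and y: "y \<in> N" for X y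
    proof -
      obtain X' where X': "is_adjoint X X'"
        using M1 X by (auto simp: von_neumann_algebra_def adjoint_closed_def)
      obtain Z where Z: "ampliation t X Z"
        using ampliation_exists [OF ht X'] .
      \<comment> \<open>The second leg of \<open>Z\<close> is the identity, which belongs to
        \<open>M2\<close>.\<close>
      have "Z \<in> op_tensors t M1 M2"
        using Z X one_in_von_neumann_algebra [OF M2]
        by (force simp: op_tensors_def ampliation_def one_bop.rep_eq)
      then have "Z \<in> ?M"
        using commutant_in_double by blast
      then have "T * tensor_mat n Z y = tensor_mat n Z y * T"
        using T y unfolding commutant_in_def [of "carrier_mat n n"] by blast
      moreover have "ampliation_mat t n (tensor_mat n X y) (tensor_mat n Z y)"
        using Z is_adjoint_scaleC [OF X']
        by (auto simp: ampliation_mat_def tensor_mat_def ampliation_def scaleC_bop.rep_eq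
            tensor_scaleC_left [OF ht])
      ultimately show ?thesis
        using slice_mat_commute [OF ht _ Tc S] by simp
    qed
    then have "S \<in> commutant_in (carrier_mat n n) {tensor_mat n X y | X y. X \<in> M1 \<and> y \<in> N}"
      using S by (auto simp: commutant_in_def slice_mat_def)
    then show "A * S = S * A"
      using A_in by (simp add: vn_tensor_mat_def commutant_in_def)
  qed
  then show ?thesis
    using A unfolding vn_tensor_mat_def ampliation_mat_def
    by (subst commutant_in_def) blast
qed

section \<open>The induced colouring\<close>

text \<open>The middle factor is block diagonal, so one of the two sums collapses. The colouring
  condition becomes a family of operator identities linear in \<open>X\<close>.\<close>

lemma tensor_mat_one_mult_index:
  fixes P :: "'a::complex_inner bop mat"
  assumes P: "P \<in> carrier_mat n n" and ij: "i < n" "j < n"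
  shows "(P * tensor_mat n X (1\<^sub>m n) * P) $$ (i, j) = (\<Sum>k<n. P $$ (i, k) * X * P $$ (k, j))"
proof -
  have T: "tensor_mat n X (1\<^sub>m n) \<in> carrier_mat n n"
    by (simp add: tensor_mat_def)
  have "(P * tensor_mat n X (1\<^sub>m n)) $$ (i, k) = P $$ (i, k) * X" if k: "k < n" for k
  proof -
    have "(P * tensor_mat n X (1\<^sub>m n)) $$ (i, k)
        = (\<Sum>l<n. P $$ (i, l) * tensor_mat n X (1\<^sub>m n) $$ (l, k))"
      by (rule mat_mult_index [OF P T ij(1) k])
    also have "\<dots> = (\<Sum>l<n. if l = k then P $$ (i, k) * X else 0)"
      using k by (intro sum.cong refl)
        (auto simp: tensor_mat_def scaleC_one scaleC_bop.rep_eq times_bop.rep_eq zero_bop.rep_eq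
          scaleC_zero_left linear_simps(3) [OF bop_bounded_linear] intro!: bop_eqI)
    finally show ?thesis
      using k by simp
  qed
  then show ?thesis
    using mat_mult_index [OF mult_carrier_mat [OF P T] P ij] by simp
qed

text \<open>The algebra \<open>N\<close> and its trace are kept and the projections are ampliated
  entrywise. Their relations then transfer from \<open>P\<close> to \<open>Q\<close> by evaluation
  on simple tensors.\<close>

lemma quantum_colorable_categorical_product:
  assumes ht: "hilbert_tensor t" and G: "is_quantum_graph G" and H: "is_quantum_graph H"
    and col: "quantum_colorable G c"
  shows "quantum_colorable (categorical_product t G H) c"
proof -
  obtain S1 M1 S2 M2 where GH: "G = (S1, M1)" "H = (S2, M2)"
    by (metis prod.exhaust)
  have M1: "von_neumann_algebra M1" and M2: "von_neumann_algebra M2"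
    using G H by (auto simp: is_quantum_graph_def GH)
  obtain n N \<tau> P where N: "matrix_von_neumann_algebra n N" "faithful_tracial_state n N \<tau>"
    and P: "\<And>a. a \<in> {1..c} \<Longrightarrow> P a \<in> vn_tensor_mat n M1 N"
      "\<And>a. a \<in> {1..c} \<Longrightarrow> P a * P a = P a"
      "\<And>a. a \<in> {1..c} \<Longrightarrow> self_adjoint_mat n (P a)"
    and P_sum: "mat n n (\<lambda>ij. \<Sum>a\<in>{1..c}. P a $$ ij) = 1\<^sub>m n"
    and P_col: "\<And>X a. X \<in> S1 \<Longrightarrow> a \<in> {1..c} \<Longrightarrow> P a * tensor_mat n X (1\<^sub>m n) * P a = 0\<^sub>m n n"
    using col unfolding quantum_colorable_def GH prod.case
    by (elim exE conjE) (rule that; blast)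
  \<comment> \<open>Self-adjointness of \<open>P a\<close> supplies the adjoint of each entry,
    namely the transposed entry, so every entry has an ampliation.\<close>
  have "\<exists>Z. ampliation t (P a $$ (i, j)) Z" if "a \<in> {1..c}" "i < n" "j < n" for a i j
    using P(3) [OF that(1)] that ampliation_exists [OF ht] unfolding self_adjoint_mat_def by metis
  then obtain Z where
    Z: "\<And>a i j. a \<in> {1..c} \<Longrightarrow> i < n \<Longrightarrow> j < n \<Longrightarrow> ampliation t (P a $$ (i, j)) (Z a i j)"
    by metis
  define Q where "Q a = mat n n (\<lambda>(i, j). Z a i j)" for a
  have Qc: "Q a \<in> carrier_mat n n" for a
    by (simp add: Q_def)
  have Pc: "P a \<in> carrier_mat n n" if "a \<in> {1..c}" for a
    using P(1) [OF that] by (simp add: vn_tensor_mat_def commutant_in_def)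
  have Q_tensor: "(Q a $$ (i, j)) (t x y) = t ((P a $$ (i, j)) x) y"
    if "a \<in> {1..c}" "i < n" "j < n" for a i j x y
    using Z [OF that] that by (simp add: Q_def ampliation_def)
  have PQ: "ampliation_mat t n (P a) (Q a)" if "a \<in> {1..c}" for a
    using Pc Qc Q_tensor P(3) [OF that] that
    unfolding ampliation_mat_def ampliation_def self_adjoint_mat_def by blast
  have Q_idem: "Q a * Q a = Q a" if a: "a \<in> {1..c}" for a
  proof (rule eq_matI)
    fix i j
    assume "i < dim_row (Q a)" "j < dim_col (Q a)"
    then have ij: "i < n" "j < n"
      by (auto simp: Q_def)
    have "((Q a * Q a) $$ (i, j)) (t x y) = (Q a $$ (i, j)) (t x y)" for x y
    proof -
      have "((Q a * Q a) $$ (i, j)) (t x y) = t (((P a * P a) $$ (i, j)) x) y"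
        by (simp add: mat_mult_index [OF _ _ ij] Qc Pc [OF a] ij bop_apply_sum times_bop.rep_eq
            Q_tensor [OF a] tensor_sum_left [OF ht])
      then show ?thesis
        by (simp add: P(2) [OF a] Q_tensor [OF a] ij)
    qed
    then show "(Q a * Q a) $$ (i, j) = Q a $$ (i, j)"
      by (rule tensor_bop_ext [OF ht])
  qed (auto simp: Q_def)
  have Q_self_adjoint: "self_adjoint_mat n (Q a)" if a: "a \<in> {1..c}" for a
    unfolding self_adjoint_mat_def
  proof (intro allI impI)
    fix i j
    assume "i < n" "j < n"
    then show "is_adjoint (Q a $$ (i, j)) (Q a $$ (j, i))"
      using P(3) [OF a] Z [OF a] unfolding self_adjoint_mat_def
      by (intro ampliation_is_adjoint [OF ht, of "P a $$ (i, j)" _ "P a $$ (j, i)"])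
        (auto simp: Q_def)
  qed
  have Q_sum: "mat n n (\<lambda>ij. \<Sum>a\<in>{1..c}. Q a $$ ij) = 1\<^sub>m n"
  proof (rule eq_matI)
    fix i j
    assume "i < dim_row (1\<^sub>m n :: 'c bop mat)" "j < dim_col (1\<^sub>m n :: 'c bop mat)"
    then have ij: "i < n" "j < n"
      by auto
    have P_ij: "(\<Sum>a\<in>{1..c}. P a $$ (i, j)) = (if i = j then 1 else 0)"
      using arg_cong [OF P_sum, of "\<lambda>A. A $$ (i, j)"] ij by simp
    have "(\<Sum>a\<in>{1..c}. Q a $$ (i, j)) = (if i = j then 1 else 0)"
    proof (rule tensor_bop_ext [OF ht])
      fix x y
      have "(\<Sum>a\<in>{1..c}. Q a $$ (i, j)) (t x y) = t ((\<Sum>a\<in>{1..c}. P a $$ (i, j)) x) y"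
        using ij by (simp add: bop_apply_sum Q_tensor tensor_sum_left [OF ht])
      also have "\<dots> = bop_apply (if i = j then 1 else 0) (t x y)"
        unfolding P_ij by (simp add: one_bop.rep_eq zero_bop.rep_eq tensor_zero_left [OF ht])
      finally show "(\<Sum>a\<in>{1..c}. Q a $$ (i, j)) (t x y) = bop_apply (if i = j then 1 else 0) (t x y)" .
    qed
    then show "mat n n (\<lambda>ij. \<Sum>a\<in>{1..c}. Q a $$ ij) $$ (i, j) = 1\<^sub>m n $$ (i, j)"
      using ij by simp
  qed auto
  have Q_col: "Q a * tensor_mat n X (1\<^sub>m n) * Q a = 0\<^sub>m n n"
    if X: "X \<in> cspan (op_tensors t S1 S2)" and a: "a \<in> {1..c}" for X a
  proof (rule eq_matI)
    fix i j
    assume "i < dim_row (0\<^sub>m n n :: 'c bop mat)" "j < dim_col (0\<^sub>m n n :: 'c bop mat)"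
    then have ij: "i < n" "j < n"
      by auto
    \<comment> \<open>The condition at a fixed entry is linear in \<open>X\<close>, so it passes
      from the generators to their span.\<close>
    let ?V = "{X. (\<Sum>k<n. Q a $$ (i, k) * X * Q a $$ (k, j)) = 0}"
    have "cspan (op_tensors t S1 S2) \<subseteq> ?V"
    proof (rule cspan_minimal)
      show "op_tensors t S1 S2 \<subseteq> ?V"
      proof
        fix W
        assume "W \<in> op_tensors t S1 S2"
        then obtain X Y where XY: "X \<in> S1" "\<And>x y. W (t x y) = t (X x) (bop_apply Y y)"
          by (auto simp: op_tensors_def)
        have 0: "(\<Sum>k<n. P a $$ (i, k) * X * P a $$ (k, j)) = 0"
          using P_col [OF XY(1) a] tensor_mat_one_mult_index [OF Pc [OF a] ij, of X] ij by simp
        have "(\<Sum>k<n. Q a $$ (i, k) * W * Q a $$ (k, j)) = 0"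
        proof (rule tensor_bop_ext [OF ht])
          fix x y
          \<comment> \<open>The entries of \<open>Q a\<close> act on the first leg only, so
            \<open>Y\<close> factors out of the sum and what remains is the colouring condition for
            \<open>X\<close> in \<open>S1\<close>.\<close>
          have "(\<Sum>k<n. Q a $$ (i, k) * W * Q a $$ (k, j)) (t x y)
              = t ((\<Sum>k<n. P a $$ (i, k) * X * P a $$ (k, j)) x) (Y y)"
            using ij by (simp add: bop_apply_sum Q_tensor [OF a] XY(2) times_bop.rep_eq
                tensor_sum_left [OF ht])
          then show "(\<Sum>k<n. Q a $$ (i, k) * W * Q a $$ (k, j)) (t x y) = bop_apply 0 (t x y)"
            by (simp add: 0 zero_bop.rep_eq tensor_zero_left [OF ht])
        qed
        then show "W \<in> ?V"
          by simp
      qed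
      have "A * (d *\<^sub>C X) * B = d *\<^sub>C (A * X * B)" for A X B :: "'c bop" and d
        by (rule bop_eqI) (simp add: times_bop.rep_eq scaleC_bop.rep_eq bop_scaleC)
      moreover have "(\<Sum>k<n. d *\<^sub>C f k) = d *\<^sub>C (\<Sum>k<n. f k)" for d and f :: "nat \<Rightarrow> 'c bop"
        by (induction n) (simp_all add: scaleC_add_right)
      ultimately show "csubspace ?V"
        by (auto simp: csubspace_def distrib_left distrib_right sum.distrib)
    qed
    then show "(Q a * tensor_mat n X (1\<^sub>m n) * Q a) $$ (i, j) = 0\<^sub>m n n $$ (i, j)"
      using X tensor_mat_one_mult_index [OF Qc ij, of a X] ij by auto
  qed (auto simp: Q_def)
  show ?thesis
    unfolding quantum_colorable_def categorical_product_def GH prod.case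
    using N ampliation_in_vn_tensor_mat [OF ht PQ M1 M2 P(1)] Q_idem Q_self_adjoint Q_sum Q_col
    by blast
qed

section \<open>Symmetry of the product and the bound\<close>

lemma hilbert_tensor_swap:
  assumes "hilbert_tensor t"
  shows "hilbert_tensor (\<lambda>b a. t a b)"
proof -
  have "{t a b | b a. True} = {t a b | a b. True}"
    by blast
  then show ?thesis
    using assms by (simp add: hilbert_tensor_def mult.commute)
qed

text \<open>Exchanging the legs changes neither the space \<open>'c\<close> nor the operators on it,
  so the two products are equal, not just isomorphic. The bound by the second factor thus reduces to
  the bound by the first.\<close>

lemma categorical_product_swap:
  "categorical_product (\<lambda>b a. t a b) H G = categorical_product t G H"
proof -
  have "op_tensors (\<lambda>b a. t a b) B A = op_tensors t A B" for A B
    unfolding op_tensors_def by blast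
  then show ?thesis
    by (simp add: categorical_product_def split: prod.splits)
qed

theorem theorem3:
  fixes t :: "'a::chilbert_space \<Rightarrow> 'b::chilbert_space \<Rightarrow> 'c::chilbert_space"
    and G :: "'a quantum_graph" and H :: "'b quantum_graph"
  assumes "hilbert_tensor t"
    and "is_quantum_graph G"
    and "is_quantum_graph H"
  shows "quantum_chromatic_number (categorical_product t G H)
    \<le> min (quantum_chromatic_number G) (quantum_chromatic_number H)"
proof (rule min.boundedI)
  \<comment> \<open>Each number of colours that suffices for a factor suffices for the product, so
    the infimum is taken over a larger set. An uncolourable factor is covered, the infimum of the
    empty set being \<infinity>.\<close>
  show "quantum_chromatic_number (categorical_product t G H) \<le> quantum_chromatic_number G"
    unfolding quantum_chromatic_number_def
    using quantum_colorable_categorical_product [OF assms] by (intro Inf_superset_mono) blast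
  show "quantum_chromatic_number (categorical_product t G H) \<le> quantum_chromatic_number H"
    unfolding quantum_chromatic_number_def
    using quantum_colorable_categorical_product [OF hilbert_tensor_swap [OF assms(1)] assms(3,2)]
    unfolding categorical_product_swap [of t H G] by (intro Inf_superset_mono) blast
qed

end
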